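(* Let $\mathcal U$ be a risk frontier with the recursive structure described in the context, suppose $\mathcal I=\{(\mathbb Y_t,\sigma_t)\}_{t\in[T+1]}$ is an information state generator for $\varrho_{\mathcal U}$, and let $X_{0:T}\in\bar{\mathcal L}_{1:T+1}$ be a Markov payoff stream. Let $\bar{\mathcal U}=\mathcal U\cap(\bar{\mathcal L}_{1:T+1}\times\bar{\mathcal L}_{0:T}\times\bar{\mathcal L}_{0:T})$. (i) If $(X_{0:T},Z_{0:T},\Phi_{0:T})\in\mathcal U$, then there exists $(X_{0:T},\bar Z_{0:T},\bar\Phi_{0:T})\in\bar{\mathcal U}$ such that $\bar\Phi_{0:T}\le\Phi_{0:T}$. (ii) $\varrho_{\bar{\mathcal U}}(X_{0:T})=\varrho_{\mathcal U}(X_{0:T})$.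
   Context: Notation: $[n]=\{0,1,\dots,n\}$. Fix a horizon $0\le T<\infty$. The data space $\Xi$ and state space $\mathbb S$ are finite, the initial state $s_0\in\mathbb S$ is fixed, and states evolve by $s_{t+1}=f_t(s_t,\xi_t)$ with $f_t:\mathbb S\times\Xi\to\mathbb S$, $t\in[T-1]$. $\Omega$ is the finite set of trajectories $\omega=(s_0,\xi_0,\dots,\xi_T)$; $\{\xi_t\}_{t\in[T]}$ are independent, $\xi_t\sim P_t\in\mathcal P(\Xi)$, with $\mathbb P=P_0\times\cdots\times P_T$. For $t\in[T+1]$, $h_t=(s_0,\xi_0,\dots,\xi_{t-1})$ is the history up to the beginning of period $t$, $\mathbb H_t$ is the set of such histories, $\mathscr F_t=\sigma(h_t)$, and $\mathcal L_t=\mathcal L^\infty(\Omega,\mathscr F_t,\mathbb P)$. $\mathcal L_{1:T+1}=\prod_{t=1}^{T+1}\mathcal L_t$, $\mathcal L_{0:T}=\prod_{t=0}^{T}\mathcal L_t$. A payoff stream is $X_{0:T}\in\mathcal L_{1:T+1}$ with $X_t\in\mathcal L_{t+1}$; a disbursement strategy $Z_{0:T}\in\mathcal L_{0:T}$ and a premium schedule $\Phi_{0:T}\in\mathcal L_{0:T}$ have $Z_t,\Phi_t\in\mathcal L_t$. $\Phi_0$ is a constant, denoted $\varphi_0$. Inequalities hold componentwise and almost surely. $[X\mid h_t]$ denotes the conditional random variable $X$ given $h_t$; for $\mathscr F_t$-measurable $Z_t$ it is the number $Z_t(h_t)$. A payoff stream is Markov if $X_t$ depends on the history $h_t$ only through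 $s_t$, so the period-$t$ conditional payoff is $[X_t\mid h_t]=[X_t\mid s_t]$. The decision maker has perfect recall: $h_t$ determines the past values $(X_{0:t-1},Z_{0:t-1},\Phi_{0:t-1})$. Risk frontier: a set $\mathcal U\subset\mathcal L_{1:T+1}\times\mathcal L_{0:T}\times\mathcal L_{0:T}$ is a risk frontier if: (i) $(X_{0:T},Z_{0:T},\Phi_{0:T})\in\mathcal U$ implies $(X'_{0:T},Z_{0:T},\Phi_{0:T})\in\mathcal U$ for all $X'_{0:T}\ge X_{0:T}$; (ii) $(X_{0:T},Z_{0:T},\Phi_{0:T})\in\mathcal U$ implies $(X_{0:T},Z_{0:T},\Phi_{0:T}+\Phi'_{0:T})\in\mathcal U$ for all non-increasing processes $\Phi'_{0:T}\ge 0$, i.e. $\Phi'_t(h_t)\ge\mathbb E[\Phi'_{t+1}\mid h_t]$ for all $h_t$ and $t\in[T-1]$; (iii) $(X_{0:T},Z_{0:T},\Phi_{0:T})\in\mathcal U$ and $Z'_{0:T}\ge Z_{0:T}$ imply $(X_{0:T},Z'_{0:T},\Phi'_{0:T})\in\mathcal U$ for some $\Phi'_{0:T}\ge\Phi_{0:T}$; (iv) $\mathcal U$ is closed. Recursive structure: a terminal input $\Phi_{T+1}\in\mathcal L_{T+1}$ is fixed and there exist correspondences $\mathcal U_t:\mathbb H_t\times\mathcal L_{t+1}\rightrightarrows\mathcal L_{t+1}\times\mathbb R\times\mathbb R$, $t\in[T]$, such that (a) $\mathcal U=\{(X_{0:T},Z_{0:T},\Phi_{0:T}):[(X_t,Z_t,\Phi_t)\mid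 h_t]\in\mathcal U_t(h_t,\Phi_{t+1}),\ \forall h_t\in\mathbb H_t,\ \forall t\in[T]\}$; (b) if $(X_t,z_t,\varphi_t)\in\mathcal U_t(h_t,\Phi_{t+1})$ and $X_t\le X'_t$ then $(X'_t,z_t,\varphi_t)\in\mathcal U_t(h_t,\Phi_{t+1})$; (c) $\Phi_{t+1}\le\Phi'_{t+1}$ implies $\mathcal U_t(h_t,\Phi'_{t+1})\subset\mathcal U_t(h_t,\Phi_{t+1})$ for all $h_t$. GCR: for a set $\mathcal V$ of triples, $\varrho_{\mathcal V}(X_{0:T})=\min_{Z_{0:T},\Phi_{0:T}}\{\varphi_0:(X_{0:T},Z_{0:T},\Phi_{0:T})\in\mathcal V\}$, applied with $\mathcal V=\mathcal U$ and $\mathcal V=\bar{\mathcal U}$ (the value of an infeasible problem is $+\infty$). Information state: $\{\mathbb Y_t\}_{t\in[T+1]}$ are Banach spaces and $\sigma_t:\mathbb H_t\to\mathbb Y_t$ are history compression functions; $\mathbb S$ is absorbed into $\mathbb Y_t$, i.e. $s_t$ is determined by (is a component of) $y_t=\sigma_t(h_t)$. $Y_t=\sigma_t(h_t)$ is the information state, $\mathcal G_t$ is the corresponding $\sigma$-field, and $\bar{\mathcal L}_t\subset\mathcal L_t$ is the set of those random variables that are functions of the information state, i.e. $X(h_t)=X(\sigma_t(h_t))$ for all $h_t\in\mathbb H_t$. $\bar{\mathcal L}_{1:T+1}=\prod_{t=1}^{T+1}\bar{\mathcal L}_t$, $\bar{\mathcal L}_{0:T}=\prod_{t=0}^T\bar{\mathcal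 L}_t$. $\mathcal I$ is an information state generator for $\varrho_{\mathcal U}$ if: (1) $\Pr(Y_{t+1}\in B\mid h_t,z_t)=\Pr(Y_{t+1}\in B\mid\sigma_t(h_t),z_t)$ for all $t\in[T-1]$, $B\in\mathcal G_{t+1}$, $h_t\in\mathbb H_t$ and $z_t\in\mathbb R$ (the period-$t$ disbursement); (2) the terminal input satisfies $\bar\Phi_{T+1}=\Phi_{T+1}\in\bar{\mathcal L}_{T+1}$; (3) for all $t\in[T]$, $\mathcal U_t(h_t,\bar\Phi_{t+1})=\mathcal U_t(h'_t,\bar\Phi_{t+1})$ for all $\bar\Phi_{t+1}\in\bar{\mathcal L}_{t+1}$ and all $h_t,h'_t\in\mathbb H_t$ with $\sigma_t(h_t)=\sigma_t(h'_t)$. *)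

theory Defs
  imports "HOL-Probability.Probability"
begin

text \<open>
  The initial state is fixed, so a history \<open>(s\<^sub>0, \<xi>\<^sub>0, \<dots>, \<xi>\<^bsub>t-1\<^esub>)\<close> is encoded by the list
  \<open>[\<xi>\<^sub>0, \<dots>, \<xi>\<^bsub>t-1\<^esub>]\<close>; a trajectory is a list of length \<open>T + 1\<close> and \<open>h\<^sub>t\<close> is \<open>take t\<close>.
\<close>

definition traj :: "nat \<Rightarrow> (nat \<Rightarrow> 'x pmf) \<Rightarrow> 'x list pmf" where
  "traj T P = map_pmf (\<lambda>\<xi>. map \<xi> [0..<Suc T]) (Pi_pmf {..T} undefined P)"

text \<open>
  Only histories of positive probability are kept.  Functions on this set are exactly the
  almost-sure equivalence classes of \<open>\<F>\<^sub>t\<close>-measurable random variables, and conditioning on such a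
  history is well defined.  If all \<open>P t\<close> have full support, these are all lists of length \<open>t\<close>.
\<close>

definition hists :: "nat \<Rightarrow> (nat \<Rightarrow> 'x pmf) \<Rightarrow> nat \<Rightarrow> 'x list set" where
  "hists T P t = take t ` set_pmf (traj T P)"

primrec state :: "(nat \<Rightarrow> 's \<Rightarrow> 'x \<Rightarrow> 's) \<Rightarrow> 's \<Rightarrow> 'x list \<Rightarrow> nat \<Rightarrow> 's" where
  "state f s0 h 0 = s0"
| "state f s0 h (Suc t) = f t (state f s0 h t) (h ! t)"

definition RV :: "nat \<Rightarrow> (nat \<Rightarrow> 'x pmf) \<Rightarrow> nat \<Rightarrow> ('x list \<Rightarrow> real) set" where
  "RV T P t = (hists T P t \<rightarrow>\<^sub>E UNIV)"

type_synonym 'x process = "nat \<Rightarrow> 'x list \<Rightarrow> real"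
type_synonym 'x triple = "'x process \<times> 'x process \<times> 'x process"

text \<open>
  The index \<open>k\<close> is the information lag: \<open>k = 0\<close> gives \<open>\<L>\<^bsub>0:T\<^esub>\<close> (disbursements and premiums) and
  \<open>k = 1\<close> gives \<open>\<L>\<^bsub>1:T+1\<^esub>\<close> (payoff streams, whose \<open>t\<close>-th component depends on \<open>h\<^bsub>t+1\<^esub>\<close>).
\<close>

definition RVs :: "nat \<Rightarrow> (nat \<Rightarrow> 'x pmf) \<Rightarrow> nat \<Rightarrow> 'x process set" where
  "RVs T P k = (\<Pi>\<^sub>E t\<in>{..T}. RV T P (t + k))"

definition rv_le :: "nat \<Rightarrow> (nat \<Rightarrow> 'x pmf) \<Rightarrow> nat \<Rightarrow> ('x list \<Rightarrow> real) \<Rightarrow> ('x list \<Rightarrow> real) \<Rightarrow> bool" where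
  "rv_le T P t V W \<longleftrightarrow> (AE \<omega> in measure_pmf (traj T P). V (take t \<omega>) \<le> W (take t \<omega>))"

definition rvs_le :: "nat \<Rightarrow> (nat \<Rightarrow> 'x pmf) \<Rightarrow> nat \<Rightarrow> 'x process \<Rightarrow> 'x process \<Rightarrow> bool" where
  "rvs_le T P k V W \<longleftrightarrow> (\<forall>t\<le>T. rv_le T P (t + k) (V t) (W t))"

definition cond_hist :: "nat \<Rightarrow> (nat \<Rightarrow> 'x pmf) \<Rightarrow> nat \<Rightarrow> 'x list \<Rightarrow> 'x list pmf" where
  "cond_hist T P t h = cond_pmf (traj T P) {\<omega>. take t \<omega> = h}"

definition nonincreasing :: "nat \<Rightarrow> (nat \<Rightarrow> 'x pmf) \<Rightarrow> 'x process \<Rightarrow> bool" where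
  "nonincreasing T P \<Phi> \<longleftrightarrow> (\<forall>t<T. \<forall>h\<in>hists T P t.
     measure_pmf.expectation (cond_hist T P t h) (\<lambda>\<omega>. \<Phi> (Suc t) (take (Suc t) \<omega>)) \<le> \<Phi> t h)"

text \<open>
  The conditional random variable \<open>[X\<^sub>t | h\<^sub>t]\<close> as an element of \<open>\<L>\<^bsub>t+1\<^esub>\<close>: the past is frozen at
  \<open>h\<close>, and the value depends on the scenario only through \<open>\<xi>\<^sub>t\<close>, the last entry of the argument.
  Since the \<open>\<xi>\<^sub>t\<close> are independent, its distribution is the conditional distribution of \<open>X\<^sub>t\<close> given
  \<open>h\<close>.
\<close>

definition cond_rv ::
    "nat \<Rightarrow> (nat \<Rightarrow> 'x pmf) \<Rightarrow> nat \<Rightarrow> ('x list \<Rightarrow> real) \<Rightarrow> 'x list \<Rightarrow> ('x list \<Rightarrow> real)" where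
  "cond_rv T P t X h = (\<lambda>h'\<in>hists T P (Suc t). X (h @ [last h']))"

definition markov_payoff ::
    "nat \<Rightarrow> (nat \<Rightarrow> 'x pmf) \<Rightarrow> (nat \<Rightarrow> 's \<Rightarrow> 'x \<Rightarrow> 's) \<Rightarrow> 's \<Rightarrow> 'x process \<Rightarrow> bool" where
  "markov_payoff T P f s0 X \<longleftrightarrow> (\<forall>t\<le>T. \<forall>h\<in>hists T P t. \<forall>h'\<in>hists T P t.
     state f s0 h t = state f s0 h' t \<longrightarrow> cond_rv T P t (X t) h = cond_rv T P t (X t) h')"

text \<open>
  The product spaces of random variables are finite-dimensional and sit inside the function types as
  closed sets, on which the product topology is the topology of the \<open>\<L>\<^sup>\<infinity>\<close> norm; hence the library
  predicate \<^const>\<open>closed\<close> expresses closedness of \<open>U\<close>.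
\<close>

definition risk_frontier :: "nat \<Rightarrow> (nat \<Rightarrow> 'x pmf) \<Rightarrow> 'x triple set \<Rightarrow> bool" where
  "risk_frontier T P U \<longleftrightarrow>
     U \<subseteq> RVs T P 1 \<times> RVs T P 0 \<times> RVs T P 0 \<and>
     (\<forall>X Z \<Phi> X'. (X, Z, \<Phi>) \<in> U \<and> X' \<in> RVs T P 1 \<and> rvs_le T P 1 X X' \<longrightarrow> (X', Z, \<Phi>) \<in> U) \<and>
     (\<forall>X Z \<Phi> \<Phi>'. (X, Z, \<Phi>) \<in> U \<and> \<Phi>' \<in> RVs T P 0 \<and> rvs_le T P 0 (\<lambda>t h. 0) \<Phi>' \<and>
        nonincreasing T P \<Phi>' \<longrightarrow>
        (X, Z, \<lambda>t\<in>{..T}. \<lambda>h\<in>hists T P t. \<Phi> t h + \<Phi>' t h) \<in> U) \<and>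
     (\<forall>X Z \<Phi> Z'. (X, Z, \<Phi>) \<in> U \<and> Z' \<in> RVs T P 0 \<and> rvs_le T P 0 Z Z' \<longrightarrow>
        (\<exists>\<Phi>'\<in>RVs T P 0. rvs_le T P 0 \<Phi> \<Phi>' \<and> (X, Z', \<Phi>') \<in> U)) \<and>
     closed U"

type_synonym 'x corr = "nat \<Rightarrow> 'x list \<Rightarrow> ('x list \<Rightarrow> real) \<Rightarrow> (('x list \<Rightarrow> real) \<times> real \<times> real) set"

definition recursive_structure ::
    "nat \<Rightarrow> (nat \<Rightarrow> 'x pmf) \<Rightarrow> 'x triple set \<Rightarrow> ('x list \<Rightarrow> real) \<Rightarrow> 'x corr \<Rightarrow> bool" where
  "recursive_structure T P U \<Phi>term Ut \<longleftrightarrow>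
     \<Phi>term \<in> RV T P (Suc T) \<and>
     (\<forall>t\<le>T. \<forall>h\<in>hists T P t. \<forall>\<Phi>\<in>RV T P (Suc t).
        Ut t h \<Phi> \<subseteq> RV T P (Suc t) \<times> UNIV \<times> UNIV) \<and>
     U = {(X, Z, \<Phi>). X \<in> RVs T P 1 \<and> Z \<in> RVs T P 0 \<and> \<Phi> \<in> RVs T P 0 \<and>
        (\<forall>t\<le>T. \<forall>h\<in>hists T P t.
           (cond_rv T P t (X t) h, Z t h, \<Phi> t h) \<in> Ut t h ((\<Phi>(Suc T := \<Phi>term)) (Suc t)))} \<and>
     (\<forall>t\<le>T. \<forall>h\<in>hists T P t. \<forall>\<Phi>\<in>RV T P (Suc t). \<forall>X X' z \<phi>.
        (X, z, \<phi>) \<in> Ut t h \<Phi> \<and> X' \<in> RV T P (Suc t) \<and> rv_le T P (Suc t) X X' \<longrightarrow>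
        (X', z, \<phi>) \<in> Ut t h \<Phi>) \<and>
     (\<forall>t\<le>T. \<forall>h\<in>hists T P t. \<forall>\<Phi>\<in>RV T P (Suc t). \<forall>\<Phi>'\<in>RV T P (Suc t).
        rv_le T P (Suc t) \<Phi> \<Phi>' \<longrightarrow> Ut t h \<Phi>' \<subseteq> Ut t h \<Phi>)"

text \<open>
  An infeasible problem has value \<open>Inf {} = \<infinity>\<close>.  The defining axioms do not guarantee that the
  minimum is attained, so the value is the infimum (equal to the minimum whenever there is one), and
  attainment is recorded separately.
\<close>

definition gcr_values :: "'x triple set \<Rightarrow> 'x process \<Rightarrow> real set" where
  "gcr_values V X = {\<Phi> 0 [] | Z \<Phi>. (X, Z, \<Phi>) \<in> V}"

definition gcr :: "'x triple set \<Rightarrow> 'x process \<Rightarrow> ereal" where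
  "gcr V X = Inf (ereal ` gcr_values V X)"

definition gcr_attained :: "'x triple set \<Rightarrow> 'x process \<Rightarrow> bool" where
  "gcr_attained V X \<longleftrightarrow> gcr V X \<in> ereal ` gcr_values V X"

text \<open>
  The Banach spaces \<open>\<Y>\<^sub>t\<close> are closed subspaces of one ambient Banach space, which loses no
  generality: finitely many Banach spaces embed into their direct sum.  The state is required to be
  a function of the information state only for \<open>t \<le> T\<close>, because \<open>s\<^bsub>T+1\<^esub>\<close> is not defined.
\<close>

definition info_state ::
    "nat \<Rightarrow> (nat \<Rightarrow> 'x pmf) \<Rightarrow> (nat \<Rightarrow> 's \<Rightarrow> 'x \<Rightarrow> 's) \<Rightarrow> 's \<Rightarrow>
     (nat \<Rightarrow> 'y::banach set) \<Rightarrow> (nat \<Rightarrow> 'x list \<Rightarrow> 'y) \<Rightarrow> bool" where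
  "info_state T P f s0 Y \<sigma> \<longleftrightarrow>
     (\<forall>t\<le>Suc T. subspace (Y t) \<and> closed (Y t) \<and> \<sigma> t \<in> hists T P t \<rightarrow> Y t) \<and>
     (\<forall>t\<le>T. \<exists>\<pi>. \<forall>h\<in>hists T P t. state f s0 h t = \<pi> (\<sigma> t h))"

definition RV_info ::
    "nat \<Rightarrow> (nat \<Rightarrow> 'x pmf) \<Rightarrow> (nat \<Rightarrow> 'x list \<Rightarrow> 'y) \<Rightarrow> nat \<Rightarrow> ('x list \<Rightarrow> real) set" where
  "RV_info T P \<sigma> t = {V \<in> RV T P t. \<exists>g. \<forall>h\<in>hists T P t. V h = g (\<sigma> t h)}"

definition RVs_info ::
    "nat \<Rightarrow> (nat \<Rightarrow> 'x pmf) \<Rightarrow> (nat \<Rightarrow> 'x list \<Rightarrow> 'y) \<Rightarrow> nat \<Rightarrow> 'x process set" where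
  "RVs_info T P \<sigma> k = (\<Pi>\<^sub>E t\<in>{..T}. RV_info T P \<sigma> (t + k))"

definition restrict_frontier ::
    "nat \<Rightarrow> (nat \<Rightarrow> 'x pmf) \<Rightarrow> (nat \<Rightarrow> 'x list \<Rightarrow> 'y) \<Rightarrow> 'x triple set \<Rightarrow> 'x triple set" where
  "restrict_frontier T P \<sigma> U =
     U \<inter> (RVs_info T P \<sigma> 1 \<times> RVs_info T P \<sigma> 0 \<times> RVs_info T P \<sigma> 0)"

text \<open>
  In the first condition, conditioning on \<open>(h\<^sub>t, z\<^sub>t)\<close> is conditioning on the events \<open>h\<^sub>t = h\<close> and
  \<open>Z\<^sub>t = z\<close> for an arbitrary period-\<open>t\<close> disbursement \<open>Z\<^sub>t \<in> \<L>\<^sub>t\<close> that pays \<open>z\<close> at \<open>h\<close> (otherwise the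
  event is null).  Disbursements do not influence the dynamics, so the condition is equivalent to
  its instance for constant disbursements.
\<close>

definition info_state_generator ::
    "nat \<Rightarrow> (nat \<Rightarrow> 'x pmf) \<Rightarrow> (nat \<Rightarrow> 's \<Rightarrow> 'x \<Rightarrow> 's) \<Rightarrow> 's \<Rightarrow>
     (nat \<Rightarrow> 'y::banach set) \<Rightarrow> (nat \<Rightarrow> 'x list \<Rightarrow> 'y) \<Rightarrow> ('x list \<Rightarrow> real) \<Rightarrow> 'x corr \<Rightarrow> bool" where
  "info_state_generator T P f s0 Y \<sigma> \<Phi>term Ut \<longleftrightarrow>
     info_state T P f s0 Y \<sigma> \<and>
     (\<forall>t<T. \<forall>B\<in>sets (restrict_space borel (Y (Suc t))). \<forall>h\<in>hists T P t. \<forall>z.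
        \<forall>Z\<in>RV T P t. Z h = z \<longrightarrow>
          measure_pmf.prob (cond_pmf (traj T P) {\<omega>. take t \<omega> = h \<and> Z (take t \<omega>) = z})
            {\<omega>. \<sigma> (Suc t) (take (Suc t) \<omega>) \<in> B} =
          measure_pmf.prob (cond_pmf (traj T P) {\<omega>. \<sigma> t (take t \<omega>) = \<sigma> t h \<and> Z (take t \<omega>) = z})
            {\<omega>. \<sigma> (Suc t) (take (Suc t) \<omega>) \<in> B}) \<and>
     \<Phi>term \<in> RV_info T P \<sigma> (Suc T) \<and>
     (\<forall>t\<le>T. \<forall>\<Phi>\<in>RV_info T P \<sigma> (Suc t). \<forall>h\<in>hists T P t. \<forall>h'\<in>hists T P t.
        \<sigma> t h = \<sigma> t h' \<longrightarrow> Ut t h \<Phi> = Ut t h' \<Phi>)"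

end

theory Submission
  imports Defs
begin

text \<open>
  In each class of histories with the same information state, pick a history at which the premium is
  minimal, and let the new strategy and premium schedule copy the old ones from there.  The premiums
  decrease, so monotonicity in the continuation premium keeps the copied decisions acceptable at the
  picked history; the conditional payoff and the correspondence depend on the history only through
  its information state, so they are acceptable on the whole class.  The premium at the unique
  history of length zero is unchanged, so both problems have the same set of values.
\<close>

lemma finite_hists: "finite (hists T P t)" for P :: "nat \<Rightarrow> 'x::finite pmf"
proof -
  have "set_pmf (traj T P) \<subseteq> {xs. set xs \<subseteq> UNIV \<and> length xs = Suc T}"
    by (auto simp: traj_def)
  then have "finite (set_pmf (traj T P))"
    by (rule finite_subset) (intro finite_lists_length_eq finite)
  then show ?thesis
    by (simp add: hists_def)
qed

lemma hists_0: "hists T P 0 = {[]}"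
  using set_pmf_not_empty[of "traj T P"] by (auto simp: hists_def)

text \<open>Every history in \<open>hists\<close> has positive probability, so almost sure
  comparison is pointwise comparison there.\<close>

lemma rv_le_iff: "rv_le T P t V W \<longleftrightarrow> (\<forall>h\<in>hists T P t. V h \<le> W h)"
  by (simp add: rv_le_def hists_def AE_measure_pmf_iff)

text \<open>A minimizer chosen from the fiber as a set, rather than for each point separately, is
  automatically constant on the fiber. Finiteness of \<open>A\<close> guarantees that the minimum is
  attained.\<close>

lemma fiberwise_minimizer:
  fixes \<phi> :: "'a \<Rightarrow> real"
  assumes "finite A"
  shows "\<exists>r. (\<forall>a\<in>A. r a \<in> A \<and> \<sigma> (r a) = \<sigma> a \<and> \<phi> (r a) \<le> \<phi> a) \<and>
    (\<forall>a b. \<sigma> a = \<sigma> b \<longrightarrow> r a = r b)"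
proof (intro exI conjI ballI allI impI)
  let ?r = "\<lambda>a. arg_min_on \<phi> {b \<in> A. \<sigma> b = \<sigma> a}"
  fix a b
  show "\<sigma> a = \<sigma> b \<Longrightarrow> ?r a = ?r b"
    by simp
  assume a: "a \<in> A"
  then have fin: "finite {b \<in> A. \<sigma> b = \<sigma> a}" and ne: "{b \<in> A. \<sigma> b = \<sigma> a} \<noteq> {}"
    using assms by auto
  show "?r a \<in> A" "\<sigma> (?r a) = \<sigma> a"
    using arg_min_if_finite(1)[OF fin ne, of \<phi>] by auto
  show "\<phi> (?r a) \<le> \<phi> a"
    using a by (intro arg_min_least[OF fin ne]) auto
qed

text \<open>The equality at the empty history is what later makes the two sets of GCR values
  coincide; the inequality between the premium schedules alone would only compare them.\<close>

lemma frontier_compress: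
  fixes P :: "nat \<Rightarrow> 'x::finite pmf"
  assumes rs: "recursive_structure T P U \<Phi>term Ut"
    and isg: "info_state_generator T P f s0 Y \<sigma> \<Phi>term Ut"
    and X: "X \<in> RVs_info T P \<sigma> 1"
    and markov: "markov_payoff T P f s0 X"
    and U: "(X, Z, \<Phi>) \<in> U"
  obtains Zbar \<Phi>bar where "(X, Zbar, \<Phi>bar) \<in> restrict_frontier T P \<sigma> U"
    and "rvs_le T P 0 \<Phi>bar \<Phi>" and "\<Phi>bar 0 [] = \<Phi> 0 []"
proof -
  have U_eq: "U = {(X, Z, \<Phi>). X \<in> RVs T P 1 \<and> Z \<in> RVs T P 0 \<and> \<Phi> \<in> RVs T P 0 \<and>
        (\<forall>t\<le>T. \<forall>h\<in>hists T P t.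
           (cond_rv T P t (X t) h, Z t h, \<Phi> t h) \<in> Ut t h ((\<Phi>(Suc T := \<Phi>term)) (Suc t)))}"
    and anti: "\<And>t h \<Phi> \<Phi>'. t \<le> T \<Longrightarrow> h \<in> hists T P t \<Longrightarrow> \<Phi> \<in> RV T P (Suc t) \<Longrightarrow>
        \<Phi>' \<in> RV T P (Suc t) \<Longrightarrow> rv_le T P (Suc t) \<Phi> \<Phi>' \<Longrightarrow> Ut t h \<Phi>' \<subseteq> Ut t h \<Phi>"
    and \<Phi>term: "\<Phi>term \<in> RV T P (Suc T)"
    using rs unfolding recursive_structure_def by blast+
  have Xm: "X \<in> RVs T P 1" and \<Phi>: "\<Phi> \<in> RVs T P 0"
    and feasible: "\<And>t h. t \<le> T \<Longrightarrow> h \<in> hists T P t \<Longrightarrow>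
        (cond_rv T P t (X t) h, Z t h, \<Phi> t h) \<in> Ut t h ((\<Phi>(Suc T := \<Phi>term)) (Suc t))"
    using U unfolding U_eq by blast+
  have \<Phi>term_info: "\<Phi>term \<in> RV_info T P \<sigma> (Suc T)"
    and Ut_eq: "\<And>t \<Phi> h h'. t \<le> T \<Longrightarrow> \<Phi> \<in> RV_info T P \<sigma> (Suc t) \<Longrightarrow> h \<in> hists T P t \<Longrightarrow>
        h' \<in> hists T P t \<Longrightarrow> \<sigma> t h = \<sigma> t h' \<Longrightarrow> Ut t h \<Phi> = Ut t h' \<Phi>"
    using isg unfolding info_state_generator_def by blast+
  have "\<forall>t\<le>T. \<exists>\<pi>. \<forall>h\<in>hists T P t. state f s0 h t = \<pi> (\<sigma> t h)"
    using isg by (simp add: info_state_generator_def info_state_def)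
  then have state_eq: "state f s0 h t = state f s0 h' t"
    if "t \<le> T" "h \<in> hists T P t" "h' \<in> hists T P t" "\<sigma> t h = \<sigma> t h'" for t h h'
    using that by metis
  \<comment> \<open>That \<open>X t\<close> is a function of the information state at time
    \<open>Suc t\<close> does not by itself compare two histories of length \<open>t\<close>. The
    Markov property does, because \<open>\<sigma> t\<close> determines the state.\<close>
  have cond_eq: "cond_rv T P t (X t) h = cond_rv T P t (X t) h'"
    if "t \<le> T" "h \<in> hists T P t" "h' \<in> hists T P t" "\<sigma> t h = \<sigma> t h'" for t h h'
    using markov state_eq[OF that] that(1-3) unfolding markov_payoff_def by blast

  have "\<forall>t. \<exists>r. (\<forall>h\<in>hists T P t. r h \<in> hists T P t \<and> \<sigma> t (r h) = \<sigma> t h \<and> \<Phi> t (r h) \<le> \<Phi> t h) \<and>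
      (\<forall>h h'. \<sigma> t h = \<sigma> t h' \<longrightarrow> r h = r h')"
    by (intro allI fiberwise_minimizer finite_hists)
  then obtain r where r_all: "\<forall>t. (\<forall>h\<in>hists T P t. r t h \<in> hists T P t \<and>
        \<sigma> t (r t h) = \<sigma> t h \<and> \<Phi> t (r t h) \<le> \<Phi> t h) \<and>
      (\<forall>h h'. \<sigma> t h = \<sigma> t h' \<longrightarrow> r t h = r t h')"
    by (rule choice[THEN exE])
  from r_all have r: "\<And>t h. h \<in> hists T P t \<Longrightarrow> r t h \<in> hists T P t"
    and \<sigma>_r: "\<And>t h. h \<in> hists T P t \<Longrightarrow> \<sigma> t (r t h) = \<sigma> t h"
    and \<Phi>_r: "\<And>t h. h \<in> hists T P t \<Longrightarrow> \<Phi> t (r t h) \<le> \<Phi> t h"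
    and r_cong: "\<And>t h h'. \<sigma> t h = \<sigma> t h' \<Longrightarrow> r t h = r t h'"
    by blast+
  \<comment> \<open>The selection \<open>r\<close> minimizes \<Phi>, but Z is copied from the same
    history, so that each copied pair of disbursement and premium is one that was jointly
    acceptable.\<close>
  define compress :: "'x process \<Rightarrow> 'x process"
    where "compress W = (\<lambda>t\<in>{..T}. \<lambda>h\<in>hists T P t. W t (r t h))" for W
  have compress_apply: "compress W t h = W t (r t h)" if "t \<le> T" "h \<in> hists T P t" for W t h
    using that by (simp add: compress_def)
  have compress_RV_info: "compress W t \<in> RV_info T P \<sigma> t" if "t \<le> T" for W t
  proof -
    \<comment> \<open>\<open>inv_into\<close> returns some history in the class of \<open>h\<close>,
      possibly not \<open>h\<close> itself; \<open>r\<close> agrees on the two, which exhibits the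
      value as a function of \<open>\<sigma> t h\<close>.\<close>
    have "compress W t h = W t (r t (inv_into (hists T P t) (\<sigma> t) (\<sigma> t h)))"
      if h: "h \<in> hists T P t" for h
    proof -
      have "\<sigma> t h = \<sigma> t (inv_into (hists T P t) (\<sigma> t) (\<sigma> t h))"
        using h by (simp add: f_inv_into_f)
      from r_cong[OF this] compress_apply[OF \<open>t \<le> T\<close> h] show ?thesis
        by metis
    qed
    then have "\<exists>g. \<forall>h\<in>hists T P t. compress W t h = g (\<sigma> t h)"
      by (intro exI[of _ "\<lambda>y. W t (r t (inv_into (hists T P t) (\<sigma> t) y))"] ballI)
    moreover have "compress W t \<in> RV T P t"
      using that by (simp add: RV_def compress_def)
    ultimately show ?thesis
      by (simp add: RV_info_def)
  qed
  then have compress_info: "compress W \<in> RVs_info T P \<sigma> 0" for W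
    by (auto simp: RVs_info_def compress_def)
  then have compress_RVs: "compress W \<in> RVs T P 0" for W
    unfolding RVs_info_def RVs_def
    by (rule subsetD[OF PiE_mono, rotated]) (auto simp: RV_info_def)
  have le: "rvs_le T P 0 (compress \<Phi>) \<Phi>"
    by (simp add: rvs_le_def rv_le_iff compress_apply \<Phi>_r)

  have "(cond_rv T P t (X t) h, compress Z t h, compress \<Phi> t h)
      \<in> Ut t h (((compress \<Phi>)(Suc T := \<Phi>term)) (Suc t))"
    if t: "t \<le> T" and h: "h \<in> hists T P t" for t h
  proof -
    let ?\<Phi> = "(\<Phi>(Suc T := \<Phi>term)) (Suc t)"
    let ?\<Phi>' = "((compress \<Phi>)(Suc T := \<Phi>term)) (Suc t)"
    \<comment> \<open>For \<open>t = T\<close> the continuation premium is the terminal input, which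
      is left uncompressed and is a function of the information state by the generator
      property.\<close>
    have info: "?\<Phi>' \<in> RV_info T P \<sigma> (Suc t)"
      using t \<Phi>term_info compress_RV_info[of "Suc t"] by auto
    have "?\<Phi> \<in> RV T P (Suc t)"
      using t \<Phi> \<Phi>term by (auto simp: RVs_def)
    moreover have "?\<Phi>' \<in> RV T P (Suc t)"
      using info by (simp add: RV_info_def)
    moreover have "rv_le T P (Suc t) ?\<Phi>' ?\<Phi>"
      using t le by (auto simp: rvs_le_def rv_le_iff)
    \<comment> \<open>The order matters: the generator property identifies the correspondences at
      \<open>r t h\<close> and \<open>h\<close> only for continuation premiums that are functions of
      the information state. So the premium is lowered first, at \<open>r t h\<close>, and the
      history is changed afterwards.\<close>
    ultimately have "Ut t (r t h) ?\<Phi> \<subseteq> Ut t (r t h) ?\<Phi>'"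
      using anti t r[OF h] by blast
    also have "\<dots> = Ut t h ?\<Phi>'"
      using Ut_eq t info r[OF h] h \<sigma>_r[OF h] by blast
    finally show ?thesis
      using feasible[OF t r[OF h]] cond_eq[OF t r[OF h] h \<sigma>_r[OF h]]
      by (auto simp: compress_apply t h)
  qed
  then have "(X, compress Z, compress \<Phi>) \<in> U"
    unfolding U_eq using Xm compress_RVs by blast
  then have "(X, compress Z, compress \<Phi>) \<in> restrict_frontier T P \<sigma> U"
    using X compress_info by (simp add: restrict_frontier_def)
  \<comment> \<open>The empty history is alone in its class, so \<open>r\<close> fixes it.\<close>
  moreover have "compress \<Phi> 0 [] = \<Phi> 0 []"
    using r[of "[]" 0] by (simp add: compress_apply hists_0)
  ultimately show ?thesis
    using that le by blast
qed

theorem theorem21: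
  fixes T :: nat
    and P :: "nat \<Rightarrow> 'x::finite pmf"
    and f :: "nat \<Rightarrow> 's::finite \<Rightarrow> 'x \<Rightarrow> 's"
    and s0 :: 's
    and U :: "'x triple set"
    and \<Phi>term :: "'x list \<Rightarrow> real"
    and Ut :: "'x corr"
    and Y :: "nat \<Rightarrow> 'y::banach set"
    and \<sigma> :: "nat \<Rightarrow> 'x list \<Rightarrow> 'y"
    and X :: "'x process"
  assumes "risk_frontier T P U"
    and "recursive_structure T P U \<Phi>term Ut"
    and "info_state_generator T P f s0 Y \<sigma> \<Phi>term Ut"
    and "X \<in> RVs_info T P \<sigma> 1"
    and "markov_payoff T P f s0 X"
  shows "(\<forall>Z \<Phi>. (X, Z, \<Phi>) \<in> U \<longrightarrow>
            (\<exists>Zbar \<Phi>bar. (X, Zbar, \<Phi>bar) \<in> restrict_frontier T P \<sigma> U \<and> rvs_le T P 0 \<Phi>bar \<Phi>)) \<and>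
         gcr (restrict_frontier T P \<sigma> U) X = gcr U X \<and>
         (gcr_attained (restrict_frontier T P \<sigma> U) X \<longleftrightarrow> gcr_attained U X)"
proof -
  have compress: "\<exists>Zbar \<Phi>bar. (X, Zbar, \<Phi>bar) \<in> restrict_frontier T P \<sigma> U \<and>
      rvs_le T P 0 \<Phi>bar \<Phi> \<and> \<Phi>bar 0 [] = \<Phi> 0 []"
    if "(X, Z, \<Phi>) \<in> U" for Z \<Phi>
    using frontier_compress[OF assms(2-5) that] by blast
  have "gcr_values U X \<subseteq> gcr_values (restrict_frontier T P \<sigma> U) X"
  proof
    fix v
    assume "v \<in> gcr_values U X"
    then obtain Z \<Phi> where "(X, Z, \<Phi>) \<in> U" and v: "v = \<Phi> 0 []"
      by (auto simp: gcr_values_def)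
    from compress[OF this(1)] obtain Zbar \<Phi>bar
      where "(X, Zbar, \<Phi>bar) \<in> restrict_frontier T P \<sigma> U" and "\<Phi>bar 0 [] = \<Phi> 0 []"
      by blast
    with v show "v \<in> gcr_values (restrict_frontier T P \<sigma> U) X"
      unfolding gcr_values_def by (intro CollectI exI[of _ Zbar] exI[of _ \<Phi>bar]) simp
  qed
  moreover have "gcr_values (restrict_frontier T P \<sigma> U) X \<subseteq> gcr_values U X"
    by (auto simp: gcr_values_def restrict_frontier_def)
  ultimately have "gcr_values (restrict_frontier T P \<sigma> U) X = gcr_values U X"
    by blast
  \<comment> \<open>Both the infimum and its attainment depend on the frontier only through this set
    of values.\<close>
  then show ?thesis
    using compress unfolding gcr_attained_def gcr_def by metis
qed

end
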